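(* Let $G$ and $H$ be graphs and let $p$ be a positive integer. Then $$(G\,\square\, H)^{[\natural p]}=\biguplus_{i=0}^{p} \left(G^{[\natural i]}\times H^{[\natural p-i]}\right)\,.$$ Equivalently, $$(G\,\square\, H)^{[\natural p]}=\biguplus_{i=1}^{p-1} \left(G^{[\natural i]}\times H^{[\natural p-i]}\right)\uplus \left(G^{[\natural p]}\,\square\, H^{[\natural p]}\right)\,.$$
   Context: For a graph $G$ and a positive integer $p$, the exact distance-$p$ graph $G^{[\natural p]}$ has vertex set $V(G)$, two vertices being adjacent iff their distance in $G$ equals exactly $p$. $G^{[\natural 0]}$ is the graph on $V(G)$ with a loop at each vertex and no other edges. If $G$ and $H$ are graphs on the same vertex set, $G\uplus H$ is the graph on that vertex set with edge set $E(G)\cup E(H)$ (and $\biguplus$ denotes the iterated version). All products have vertex set $V(G)\times V(H)$. In the Cartesian product $G\,\square\,H$, $(g_1,h_1)(g_2,h_2)$ is an edge iff either $g_1g_2\in E(G)$ and $h_1=h_2$, or $g_1=g_2$ and $h_1h_2\in E(H)$. In the direct product $G\times H$, $(g_1,h_1)(g_2,h_2)$ is an edge iff $g_1g_2\in E(G)$ and $h_1h_2\in E(H)$ (where a loop at $g$ counts as $gg\in E(G)$). Equalities are equalities of graphs on the common vertex set $V(G)\times V(H)$. *)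

theory Defs
  imports "Graph_Theory.Pair_Digraph" "Graph_Theory.Shortest_Path"
begin

text \<open>
  An undirected graph, possibly infinite and possibly with loops, is a
  \<^locale>\<open>pair_sym_digraph\<close>: the edge between u and v is represented by the arcs (u,v) and (v,u),
  and a loop at v by the arc (v,v).
\<close>

definition gdist :: "'a pair_pre_digraph \<Rightarrow> 'a \<Rightarrow> 'a \<Rightarrow> ereal" where
  "gdist G u v = wf_digraph.\<mu> (with_proj G) (\<lambda>_. 1) u v"

definition exact_distance_graph :: "'a pair_pre_digraph \<Rightarrow> nat \<Rightarrow> 'a pair_pre_digraph" where
  "exact_distance_graph G p = \<lparr> pverts = pverts G,
     parcs = (if p = 0 then {(v, v) | v. v \<in> pverts G}
              else {(u, v). u \<in> pverts G \<and> v \<in> pverts G \<and> gdist G u v = ereal (real p)}) \<rparr>"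

definition graph_union ::
    "'a pair_pre_digraph \<Rightarrow> 'a pair_pre_digraph \<Rightarrow> 'a pair_pre_digraph" (infixl \<open>\<uplus>\<close> 65) where
  "G \<uplus> H = \<lparr> pverts = pverts G \<union> pverts H, parcs = parcs G \<union> parcs H \<rparr>"

text \<open>
  The iterated union over an empty index set is the graph without vertices, the neutral element
  of \<open>\<uplus>\<close>.
\<close>

definition graph_Union :: "'i set \<Rightarrow> ('i \<Rightarrow> 'a pair_pre_digraph) \<Rightarrow> 'a pair_pre_digraph" where
  "graph_Union I F = \<lparr> pverts = (\<Union>i\<in>I. pverts (F i)), parcs = (\<Union>i\<in>I. parcs (F i)) \<rparr>"

syntax "_graph_Union" :: "pttrn \<Rightarrow> 'i set \<Rightarrow> 'a pair_pre_digraph \<Rightarrow> 'a pair_pre_digraph"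
  (\<open>(3\<Uplus>_\<in>_./ _)\<close> [0, 0, 10] 10)
translations "\<Uplus>i\<in>I. G" \<rightleftharpoons> "CONST graph_Union I (\<lambda>i. G)"

definition cartesian_product ::
    "'a pair_pre_digraph \<Rightarrow> 'b pair_pre_digraph \<Rightarrow> ('a \<times> 'b) pair_pre_digraph"
    (infixl \<open>\<box>\<close> 70) where
  "G \<box> H = \<lparr> pverts = pverts G \<times> pverts H,
     parcs = {((g1, h1), (g2, h2)) | g1 h1 g2 h2.
       ((g1, g2) \<in> parcs G \<and> h1 = h2 \<and> h1 \<in> pverts H) \<or>
       (g1 = g2 \<and> g1 \<in> pverts G \<and> (h1, h2) \<in> parcs H)} \<rparr>"

definition direct_product ::
    "'a pair_pre_digraph \<Rightarrow> 'b pair_pre_digraph \<Rightarrow> ('a \<times> 'b) pair_pre_digraph"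
    (infixl \<open>\<times>\<^sub>d\<close> 70) where
  "G \<times>\<^sub>d H = \<lparr> pverts = pverts G \<times> pverts H,
     parcs = {((g1, h1), (g2, h2)) | g1 h1 g2 h2.
       (g1, g2) \<in> parcs G \<and> (h1, h2) \<in> parcs H} \<rparr>"

lemma pair_sym_digraph_iff:
  "pair_sym_digraph G \<longleftrightarrow> parcs G \<subseteq> pverts G \<times> pverts G \<and> sym (parcs G)"
  unfolding pair_sym_digraph_def pair_sym_digraph_axioms_def pair_wf_digraph_def symmetric_def
  by force

lemma pair_sym_digraph_cartesian_product:
  "pair_sym_digraph G \<Longrightarrow> pair_sym_digraph H \<Longrightarrow> pair_sym_digraph (G \<box> H)"
  unfolding pair_sym_digraph_iff cartesian_product_def by (auto simp: sym_def)

lemma gdist_eq: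
  assumes "pair_sym_digraph G"
  shows "gdist G u v = (INF p \<in> {p. pre_digraph.awalk (with_proj G) u p v}. ereal (real (length p)))"
proof -
  interpret pair_sym_digraph G by (rule assms)
  have "awalk_cost (\<lambda>_. 1) p = real (length p)" for p :: "('a \<times> 'a) list"
    by (induction p) auto
  then show ?thesis
    unfolding gdist_def wf_digraph.\<mu>_def[OF wf_digraph_axioms] by simp
qed

end

theory Submission
  imports Defs "HOL-Library.Set_Algebras"
begin

text \<open>
  A walk in the Cartesian product is an interleaving of a walk in each factor, so the lengths of
  the walks between two vertices of \<open>G \<box> H\<close> are exactly the sums of a walk length in \<open>G\<close> and a
  walk length in \<open>H\<close>. Taking minima, distances in the product are sums of distances in the
  factors, and a distance equal to \<open>p\<close> splits as \<open>i + (p - i)\<close>.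
\<close>

definition walk_lengths :: "'a pair_pre_digraph \<Rightarrow> 'a \<Rightarrow> 'a \<Rightarrow> nat set" where
  "walk_lengths G u v = {n. u \<in> pverts G \<and> v \<in> pverts G \<and> (u, v) \<in> parcs G ^^ n}"
  \<comment> \<open>\<open>R ^^ 0\<close> is the identity on the whole type, hence the restriction to vertices.\<close>

lemma zero_in_walk_lengths_iff: "0 \<in> walk_lengths G u v \<longleftrightarrow> u = v \<and> u \<in> pverts G"
  by (auto simp: walk_lengths_def)

lemma (in pair_wf_digraph) awalk_imp_relpow_length:
  "awalk u p v \<Longrightarrow> (u, v) \<in> parcs G ^^ length p"
proof (induction p arbitrary: u)
  case Nil
  then show ?case by (simp add: awalk_Nil_iff)
next
  case (Cons e p)
  then have "(u, snd e) \<in> parcs G" and "(snd e, v) \<in> parcs G ^^ length p"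
    by (auto simp: awalk_Cons_iff)
  then show ?case
    by (simp only: length_Cons relpow_Suc_I2)
qed

lemma (in pair_wf_digraph) relpow_imp_ex_awalk:
  "(u, v) \<in> parcs G ^^ n \<Longrightarrow> u \<in> pverts G \<Longrightarrow> \<exists>p. awalk u p v \<and> length p = n"
proof (induction n arbitrary: u)
  case 0
  then show ?case by (simp add: awalk_Nil_iff)
next
  case (Suc n)
  then obtain w where arc: "(u, w) \<in> parcs G" and "(w, v) \<in> parcs G ^^ n"
    by (blast dest: relpow_Suc_D2)
  then obtain p where "awalk w p v" and "length p = n"
    using Suc.IH in_arcsD2 by blast
  with arc have "awalk u ((u, w) # p) v" and "length ((u, w) # p) = Suc n"
    by (auto simp: awalk_Cons_iff)
  then show ?case by blast
qed

lemma (in pair_wf_digraph) length_image_awalks: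
  "length ` {p. awalk u p v} = walk_lengths G u v"
proof
  show "length ` {p. awalk u p v} \<subseteq> walk_lengths G u v"
    by (auto simp: walk_lengths_def awalk_imp_relpow_length
        dest: awalk_hd_in_verts awalk_last_in_verts)
  show "walk_lengths G u v \<subseteq> length ` {p. awalk u p v}"
    using relpow_imp_ex_awalk by (fastforce simp: walk_lengths_def)
qed

lemma pverts_cartesian_product [simp]: "pverts (G \<box> H) = pverts G \<times> pverts H"
  by (simp add: cartesian_product_def)

lemma parcs_cartesian_product_iff:
  "((g, h), (g', h')) \<in> parcs (G \<box> H) \<longleftrightarrow>
    (g, g') \<in> parcs G \<and> h = h' \<and> h \<in> pverts H \<or> g = g' \<and> g \<in> pverts G \<and> (h, h') \<in> parcs H"
  by (auto simp: cartesian_product_def)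

lemma relpow_cartesian_product_imp_relpow_factors:
  "((g, h), (g', h')) \<in> parcs (G \<box> H) ^^ n \<Longrightarrow>
    \<exists>i j. n = i + j \<and> (g, g') \<in> parcs G ^^ i \<and> (h, h') \<in> parcs H ^^ j"
proof (induction n arbitrary: g' h')
  case 0
  then show ?case by simp
next
  case (Suc n)
  then obtain x y where walk: "((g, h), (x, y)) \<in> parcs (G \<box> H) ^^ n"
    and arc: "((x, y), (g', h')) \<in> parcs (G \<box> H)"
    by auto
  from Suc.IH[OF walk] obtain i j
    where ij: "n = i + j" "(g, x) \<in> parcs G ^^ i" "(h, y) \<in> parcs H ^^ j"
    by blast
  from arc consider (left) "(x, g') \<in> parcs G" "y = h'" | (right) "x = g'" "(y, h') \<in> parcs H"
    by (auto simp: parcs_cartesian_product_iff)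
  then show ?case
  proof cases
    case left
    with ij have "Suc n = Suc i + j" "(g, g') \<in> parcs G ^^ Suc i" "(h, h') \<in> parcs H ^^ j"
      by auto
    then show ?thesis by blast
  next
    case right
    with ij have "Suc n = i + Suc j" "(g, g') \<in> parcs G ^^ i" "(h, h') \<in> parcs H ^^ Suc j"
      by auto
    then show ?thesis by blast
  qed
qed

lemma relpow_homomorphism:
  assumes "\<And>x y. (x, y) \<in> R \<Longrightarrow> (f x, f y) \<in> S" and "(a, b) \<in> R ^^ n"
  shows "(f a, f b) \<in> S ^^ n"
  using assms(2) by (induction n arbitrary: b) (auto intro: assms(1))

lemma relpow_factors_imp_relpow_cartesian_product:
  assumes "(g, g') \<in> parcs G ^^ i" and "(h, h') \<in> parcs H ^^ j"
    and "g' \<in> pverts G" and "h \<in> pverts H"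
  shows "((g, h), (g', h')) \<in> parcs (G \<box> H) ^^ (i + j)"
proof (rule relpow_trans)
  show "((g, h), (g', h)) \<in> parcs (G \<box> H) ^^ i"
    using assms(4) by (intro relpow_homomorphism[OF _ assms(1), where f = "\<lambda>x. (x, h)"])
      (simp add: parcs_cartesian_product_iff)
  show "((g', h), (g', h')) \<in> parcs (G \<box> H) ^^ j"
    using assms(3) by (intro relpow_homomorphism[OF _ assms(2), where f = "\<lambda>y. (g', y)"])
      (simp add: parcs_cartesian_product_iff)
qed

lemma walk_lengths_cartesian_product:
  "walk_lengths (G \<box> H) (g, h) (g', h') = walk_lengths G g g' + walk_lengths H h h'"
proof
  show "walk_lengths (G \<box> H) (g, h) (g', h') \<subseteq> walk_lengths G g g' + walk_lengths H h h'"
    by (auto simp: walk_lengths_def set_plus_def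
        dest!: relpow_cartesian_product_imp_relpow_factors)
  show "walk_lengths G g g' + walk_lengths H h h' \<subseteq> walk_lengths (G \<box> H) (g, h) (g', h')"
    by (auto simp: walk_lengths_def elim!: set_plus_elim
        intro: relpow_factors_imp_relpow_cartesian_product)
qed

lemma set_plus_eq_empty_iff:
  fixes A B :: "'a::plus set"
  shows "A + B = {} \<longleftrightarrow> A = {} \<or> B = {}"
  by (auto simp: set_plus_def)

lemma Inf_nat_set_plus:
  fixes A B :: "nat set"
  assumes "A \<noteq> {}" and "B \<noteq> {}"
  shows "Inf (A + B) = Inf A + Inf B"
proof (rule cInf_eq_minimum)
  show "Inf A + Inf B \<in> A + B"
    using assms by (intro set_plus_intro Inf_nat_def1)
  show "Inf A + Inf B \<le> n" if "n \<in> A + B" for n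
    using that by (auto elim!: set_plus_elim intro!: add_mono wellorder_Inf_le1)
qed

lemma INF_ereal_of_nat:
  fixes A :: "nat set"
  shows "(INF n\<in>A. ereal (real n)) = (if A = {} then \<infinity> else ereal (real (Inf A)))"
proof (cases "A = {}")
  case True
  then show ?thesis by (simp add: top_ereal_def)
next
  case False
  then have "(INF n\<in>A. ereal (real n)) = ereal (real (Inf A))"
    by (intro antisym INF_greatest INF_lower Inf_nat_def1) (auto simp: wellorder_Inf_le1)
  with False show ?thesis by simp
qed

lemma gdist_eq_Inf_walk_lengths:
  assumes "pair_sym_digraph G"
  shows "gdist G u v =
    (if walk_lengths G u v = {} then \<infinity> else ereal (real (Inf (walk_lengths G u v))))"
proof -
  interpret pair_sym_digraph G by (rule assms)
  have "gdist G u v = (INF n\<in>walk_lengths G u v. ereal (real n))"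
    unfolding gdist_eq[OF assms] length_image_awalks[symmetric] by (simp add: image_image)
  then show ?thesis by (simp add: INF_ereal_of_nat)
qed

lemma gdist_eq_infinity_or_nat:
  assumes "pair_sym_digraph G"
  obtains "gdist G u v = \<infinity>" | n where "gdist G u v = ereal (real n)"
  using that by (metis gdist_eq_Inf_walk_lengths[OF assms])

lemma gdist_eq_of_nat_imp_in_walk_lengths:
  assumes "pair_sym_digraph G" and "gdist G u v = ereal (real n)"
  shows "n \<in> walk_lengths G u v"
  using assms(2) Inf_nat_def1[of "walk_lengths G u v"]
  by (auto simp: gdist_eq_Inf_walk_lengths[OF assms(1)] split: if_splits)

lemma gdist_refl:
  assumes "pair_sym_digraph G" and "v \<in> pverts G"
  shows "gdist G v v = 0"
proof -
  have "0 \<in> walk_lengths G v v"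
    using assms(2) by (simp add: zero_in_walk_lengths_iff)
  then show ?thesis
    by (auto simp: gdist_eq_Inf_walk_lengths[OF assms(1)] dest: wellorder_Inf_le1)
qed

lemma gdist_cartesian_product:
  assumes "pair_sym_digraph G" and "pair_sym_digraph H"
  shows "gdist (G \<box> H) (g, h) (g', h') = gdist G g g' + gdist H h h'"
  by (simp add: gdist_eq_Inf_walk_lengths assms pair_sym_digraph_cartesian_product
      walk_lengths_cartesian_product Inf_nat_set_plus set_plus_eq_empty_iff)

lemma gdist_cartesian_product_eq_of_nat_iff:
  assumes "pair_sym_digraph G" and "pair_sym_digraph H"
  shows "gdist (G \<box> H) (g, h) (g', h') = ereal (real p) \<longleftrightarrow>
    (\<exists>i\<le>p. gdist G g g' = ereal (real i) \<and> gdist H h h' = ereal (real (p - i)))"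
proof
  assume "gdist (G \<box> H) (g, h) (g', h') = ereal (real p)"
  then obtain i j where "gdist G g g' = ereal (real i)" and "gdist H h h' = ereal (real j)"
    and "real i + real j = real p"
    by (cases rule: gdist_eq_infinity_or_nat[OF assms(1), of g g'];
        cases rule: gdist_eq_infinity_or_nat[OF assms(2), of h h'])
      (auto simp: gdist_cartesian_product[OF assms])
  moreover from this(3) have "p = i + j" by linarith
  ultimately show "\<exists>i\<le>p. gdist G g g' = ereal (real i) \<and> gdist H h h' = ereal (real (p - i))"
    by (intro exI[of _ i]) simp
qed (auto simp: gdist_cartesian_product[OF assms])

lemma pverts_exact_distance_graph [simp]: "pverts (exact_distance_graph G p) = pverts G"
  by (simp add: exact_distance_graph_def)

lemma parcs_exact_distance_graph_iff:
  assumes "pair_sym_digraph G"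
  shows "(u, v) \<in> parcs (exact_distance_graph G p) \<longleftrightarrow> gdist G u v = ereal (real p)"
proof (cases "p = 0")
  case True
  have "gdist G u v = 0 \<longleftrightarrow> u = v \<and> u \<in> pverts G"
    using gdist_eq_of_nat_imp_in_walk_lengths[OF assms, of u v 0] gdist_refl[OF assms]
    by (auto simp: zero_in_walk_lengths_iff zero_ereal_def)
  with True show ?thesis
    by (auto simp: exact_distance_graph_def zero_ereal_def)
next
  case False
  have "u \<in> pverts G \<and> v \<in> pverts G" if "gdist G u v = ereal (real p)"
    using gdist_eq_of_nat_imp_in_walk_lengths[OF assms that] by (simp add: walk_lengths_def)
  with False show ?thesis by (auto simp: exact_distance_graph_def)
qed

lemma exact_distance_graph_0_exact_distance_graph [simp]:
  "exact_distance_graph (exact_distance_graph G p) 0 = exact_distance_graph G 0"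
  by (simp add: exact_distance_graph_def)

lemma graph_Union_Un: "graph_Union (I \<union> J) F = graph_Union I F \<uplus> graph_Union J F"
  by (simp add: graph_Union_def graph_union_def)

lemma graph_Union_doubleton: "graph_Union {i, j} F = F i \<uplus> F j"
  by (simp add: graph_Union_def graph_union_def)

lemma cartesian_product_eq_union_direct_products:
  "G \<box> H = (exact_distance_graph G 0 \<times>\<^sub>d H) \<uplus> (G \<times>\<^sub>d exact_distance_graph H 0)"
  by (auto simp: cartesian_product_def direct_product_def graph_union_def exact_distance_graph_def)

lemma exact_distance_graph_cartesian_product:
  assumes "pair_sym_digraph G" and "pair_sym_digraph H"
  shows "exact_distance_graph (G \<box> H) p =
    (\<Uplus>i\<in>{0..p}. exact_distance_graph G i \<times>\<^sub>d exact_distance_graph H (p - i))"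
proof (rule pair_pre_digraph.equality)
  show "parcs (exact_distance_graph (G \<box> H) p) =
      parcs (\<Uplus>i\<in>{0..p}. exact_distance_graph G i \<times>\<^sub>d exact_distance_graph H (p - i))"
    by (auto simp: graph_Union_def direct_product_def parcs_exact_distance_graph_iff assms
        pair_sym_digraph_cartesian_product gdist_cartesian_product_eq_of_nat_iff)
qed (simp_all add: graph_Union_def direct_product_def)

theorem theorem2p2:
  fixes G :: "'a pair_pre_digraph" and H :: "'b pair_pre_digraph" and p :: nat
  assumes "pair_sym_digraph G" and "pair_sym_digraph H" and "p > 0"
  shows "exact_distance_graph (G \<box> H) p =
           (\<Uplus>i\<in>{0..p}. exact_distance_graph G i \<times>\<^sub>d exact_distance_graph H (p - i))
       \<and> exact_distance_graph (G \<box> H) p =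
           (\<Uplus>i\<in>{1..p - 1}. exact_distance_graph G i \<times>\<^sub>d exact_distance_graph H (p - i))
             \<uplus> (exact_distance_graph G p \<box> exact_distance_graph H p)"
proof -
  let ?F = "\<lambda>i. exact_distance_graph G i \<times>\<^sub>d exact_distance_graph H (p - i)"
  have all_terms: "exact_distance_graph (G \<box> H) p = graph_Union {0..p} ?F"
    using assms(1,2) by (rule exact_distance_graph_cartesian_product)
  have "{0..p} = {1..p - 1} \<union> {0, p}"
    using assms(3) by auto
  then have "graph_Union {0..p} ?F = graph_Union {1..p - 1} ?F \<uplus> (?F 0 \<uplus> ?F p)"
    by (simp only: graph_Union_Un graph_Union_doubleton)
  also have "?F 0 \<uplus> ?F p = exact_distance_graph G p \<box> exact_distance_graph H p"
    by (simp add: cartesian_product_eq_union_direct_products)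
  finally show ?thesis
    using all_terms by simp
qed

end
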